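(* Let $\mathfrak g$ be the seven-dimensional approximate symmetry Lie algebra of the Gardner equation $w_t-6(w+\varepsilon w^2)w_x+w_{xxx}=0$, with basis $\mathbf v_1,\dots,\mathbf v_7$. An optimal system of one-dimensional subalgebras of $\mathfrak g$ is provided by the subalgebras spanned by $$\mathbf v_1,\qquad \mathbf v_4,\qquad \mathbf v_2+\alpha\mathbf v_6,\qquad \mathbf v_5+\alpha\mathbf v_1,\qquad \mathbf v_3+\alpha\mathbf v_2+\beta\mathbf v_5,$$ $$\mathbf v_6+\alpha\mathbf v_1+\beta\mathbf v_5,\qquad \mathbf v_7+\alpha\mathbf v_1+\beta\mathbf v_2+\gamma\mathbf v_3,$$ where $\alpha,\beta,\gamma$ range over the real numbers.
   Context: The basis of $\mathfrak g$ consists of the first-order approximate symmetries (operators taken modulo $o(\varepsilon)$, so $\varepsilon^2$-terms are discarded) $$\mathbf v_1=\partial_x,\quad \mathbf v_2=\partial_t,\quad \mathbf v_3=6t\,\partial_x+(2\varepsilon w-1)\,\partial_w,\quad \mathbf v_4=\varepsilon\,\partial_x,\quad \mathbf v_5=\varepsilon\,\partial_t,$$ $$\mathbf v_6=\varepsilon(6t\,\partial_x-\partial_w),\quad \mathbf v_7=\varepsilon(x\,\partial_x+3t\,\partial_t-2w\,\partial_w).$$ As an abstract real Lie algebra, $\mathfrak g$ has basis $\mathbf v_1,\dots,\mathbf v_7$ and nonzero brackets (up to antisymmetry) $$[\mathbf v_1,\mathbf v_7]=\mathbf v_4,\quad [\mathbf v_2,\mathbf v_3]=6\mathbf v_1,\quad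 [\mathbf v_2,\mathbf v_6]=6\mathbf v_4,\quad [\mathbf v_2,\mathbf v_7]=3\mathbf v_5,\quad [\mathbf v_3,\mathbf v_5]=-6\mathbf v_4,\quad [\mathbf v_3,\mathbf v_7]=-2\mathbf v_6.$$ The adjoint representation is given by the Lie series $\mathrm{Ad}(\exp(\mu\mathbf v_i))\mathbf v_j=\mathbf v_j-\mu[\mathbf v_i,\mathbf v_j]+\frac{\mu^2}{2}[\mathbf v_i,[\mathbf v_i,\mathbf v_j]]-\cdots=\exp(\mathrm{ad}(-\mu\mathbf v_i))\mathbf v_j$, $\mu\in\mathbb R$. Two subalgebras $\mathfrak h,\tilde{\mathfrak h}$ of $\mathfrak g$ are equivalent if $\tilde{\mathfrak h}=\mathrm{Ad}(g)\mathfrak h$ for some $g$ in the connected Lie group with Lie algebra $\mathfrak g$, i.e. if $\mathfrak h$ is mapped onto $\tilde{\mathfrak h}$ by a finite composition of maps $\mathrm{Ad}(\exp(\mu\mathbf v_i))$. An optimal system of one-dimensional subalgebras is a list of one-dimensional subalgebras such that every one-dimensional subalgebra of $\mathfrak g$ is equivalent to a unique member of the list. *)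

theory Defs
  imports "HOL-Analysis.Analysis" "HOL-Library.Function_Algebras"
begin

section \<open>Functions with the pointwise vector space structure\<close>

instantiation "fun" :: (type, real_vector) real_vector
begin

definition scaleR_fun :: "real \<Rightarrow> ('a \<Rightarrow> 'b) \<Rightarrow> 'a \<Rightarrow> 'b" where
  "scaleR_fun c f = (\<lambda>x. c *\<^sub>R f x)"

instance
  by standard (simp_all add: scaleR_fun_def fun_eq_iff scaleR_right_distrib scaleR_left_distrib)

end


section \<open>First-order approximate operators\<close>

text \<open>A point \<open>(x, t, w)\<close> consists of the independent variables \<open>x\<close>, \<open>t\<close> and the dependent
  variable \<open>w\<close>; the vector field \<open>\<xi> \<partial>\<^sub>x + \<tau> \<partial>\<^sub>t + \<eta> \<partial>\<^sub>w\<close> is the function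
  \<open>(x, t, w) \<mapsto> (\<xi>, \<tau>, \<eta>)\<close>.\<close>

type_synonym vfield = "real \<times> real \<times> real \<Rightarrow> real \<times> real \<times> real"

definition vf_bracket :: "vfield \<Rightarrow> vfield \<Rightarrow> vfield" where
  "vf_bracket X Y = (\<lambda>p. frechet_derivative Y (at p) (X p) - frechet_derivative X (at p) (Y p))"

text \<open>The pair \<open>(X\<^sub>0, X\<^sub>1)\<close> stands for the operator \<open>X\<^sub>0 + \<epsilon> X\<^sub>1\<close> modulo \<open>o(\<epsilon>)\<close>, so that the
  \<open>\<epsilon>\<^sup>2\<close>-term \<open>[X\<^sub>1, Y\<^sub>1]\<close> of a commutator is discarded and \<open>\<epsilon>\<close> annihilates \<open>\<epsilon> X\<^sub>1\<close>.\<close>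

type_synonym approx_op = "vfield \<times> vfield"

definition approx_bracket :: "approx_op \<Rightarrow> approx_op \<Rightarrow> approx_op" where
  "approx_bracket X Y =
     (vf_bracket (fst X) (fst Y), vf_bracket (fst X) (snd Y) + vf_bracket (snd X) (fst Y))"

definition eps_times :: "approx_op \<Rightarrow> approx_op" where
  "eps_times X = (0, fst X)"


section \<open>The approximate symmetry algebra of the Gardner equation\<close>

text \<open>First-order approximate symmetries of \<open>w\<^sub>t - 6 (w + \<epsilon> w\<^sup>2) w\<^sub>x + w\<^sub>x\<^sub>x\<^sub>x = 0\<close>; for instance
  \<open>v3\<close> is \<open>6 t \<partial>\<^sub>x + (2 \<epsilon> w - 1) \<partial>\<^sub>w\<close>.\<close>

definition v1 :: approx_op where "v1 = ((\<lambda>(x, t, w). (1, 0, 0)), 0)"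
definition v2 :: approx_op where "v2 = ((\<lambda>(x, t, w). (0, 1, 0)), 0)"
definition v3 :: approx_op where
  "v3 = ((\<lambda>(x, t, w). (6 * t, 0, - 1)), (\<lambda>(x, t, w). (0, 0, 2 * w)))"
definition v4 :: approx_op where "v4 = eps_times v1"
definition v5 :: approx_op where "v5 = eps_times v2"
definition v6 :: approx_op where "v6 = eps_times ((\<lambda>(x, t, w). (6 * t, 0, - 1)), 0)"
definition v7 :: approx_op where "v7 = eps_times ((\<lambda>(x, t, w). (x, 3 * t, - 2 * w)), 0)"

definition gardner_basis :: "approx_op set" where
  "gardner_basis = {v1, v2, v3, v4, v5, v6, v7}"

definition gardner_algebra :: "approx_op set" where
  "gardner_algebra = span gardner_basis"


section \<open>One-dimensional subalgebras and their equivalence\<close>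

definition one_dim_subalgebra :: "approx_op set \<Rightarrow> bool" where
  "one_dim_subalgebra h \<longleftrightarrow>
     subspace h \<and> h \<subseteq> gardner_algebra \<and> (\<forall>X\<in>h. \<forall>Y\<in>h. approx_bracket X Y \<in> h) \<and> dim h = 1"

text \<open>The Lie series for \<open>Ad (exp (\<mu> v)) X\<close>; convergence is pointwise, function types carrying
  the product topology.\<close>

definition Ad_exp :: "real \<Rightarrow> approx_op \<Rightarrow> approx_op \<Rightarrow> approx_op" where
  "Ad_exp \<mu> v X = (\<Sum>n. ((- \<mu>) ^ n / fact n) *\<^sub>R (approx_bracket v ^^ n) X)"

inductive_set Ad_group :: "(approx_op \<Rightarrow> approx_op) set" where
  id: "id \<in> Ad_group"
| step: "\<phi> \<in> Ad_group \<Longrightarrow> v \<in> gardner_basis \<Longrightarrow> Ad_exp \<mu> v \<circ> \<phi> \<in> Ad_group"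

definition equivalent_subalgebras :: "approx_op set \<Rightarrow> approx_op set \<Rightarrow> bool" where
  "equivalent_subalgebras h h' \<longleftrightarrow> (\<exists>\<phi>\<in>Ad_group. h' = \<phi> ` h)"

definition optimal_system :: "approx_op set set \<Rightarrow> bool" where
  "optimal_system L \<longleftrightarrow>
     (\<forall>k\<in>L. one_dim_subalgebra k) \<and>
     (\<forall>h. one_dim_subalgebra h \<longrightarrow> (\<exists>!k. k \<in> L \<and> equivalent_subalgebras h k))"


section \<open>Consistency of the operators with the abstract presentation\<close>

text \<open>The library has no Hausdorff instance for function types, but limits are unique.\<close>

lemma approx_op_sums_unique:
  fixes f :: "nat \<Rightarrow> approx_op"
  assumes "f sums X"
  shows "suminf f = X"
proof -
  have "Y = X" if "f sums Y" for Y
  proof -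
    have lim: "(\<lambda>n. fst (\<Sum>i<n. f i) p) \<longlonglongrightarrow> fst Z p" "(\<lambda>n. snd (\<Sum>i<n. f i) p) \<longlonglongrightarrow> snd Z p"
      if "f sums Z" for Z p
    proof -
      have "continuous_on UNIV (\<lambda>h :: vfield. h p)"
        by (rule continuous_on_product_coordinates)
      then have ev: "((\<lambda>h :: vfield. h p) \<longlongrightarrow> h p) (nhds h)" for h
        using tendsto_at_iff_tendsto_nhds[of "\<lambda>h :: vfield. h p" h]
        by (simp add: continuous_on_def)
      show "(\<lambda>n. fst (\<Sum>i<n. f i) p) \<longlonglongrightarrow> fst Z p" "(\<lambda>n. snd (\<Sum>i<n. f i) p) \<longlonglongrightarrow> snd Z p"
        using filterlim_compose[OF ev tendsto_fst[OF that[unfolded sums_def]]]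
          filterlim_compose[OF ev tendsto_snd[OF that[unfolded sums_def]]] .
    qed
    show ?thesis
      by (intro prod_eqI ext LIMSEQ_unique[OF lim(1)[OF that] lim(1)[OF assms]]
          LIMSEQ_unique[OF lim(2)[OF that] lim(2)[OF assms]])
  qed
  then show ?thesis
    unfolding suminf_def using assms by (rule the_equality[rotated])
qed

lemma vf_bracket_affine:
  assumes "bounded_linear A" "bounded_linear B"
  shows "vf_bracket (\<lambda>p. A p + a) (\<lambda>p. B p + b) = (\<lambda>p. B (A p + a) - A (B p + b))"
proof
  fix p
  have "((\<lambda>p. A p + a) has_derivative A) (at p)" "((\<lambda>p. B p + b) has_derivative B) (at p)"
    using assms by (auto intro!: derivative_eq_intros bounded_linear_imp_has_derivative)
  from this[THEN frechet_derivative_at]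
  show "vf_bracket (\<lambda>p. A p + a) (\<lambda>p. B p + b) p = B (A p + a) - A (B p + b)"
    unfolding vf_bracket_def by metis
qed

definition affine_field :: "real \<Rightarrow> real \<Rightarrow> real \<Rightarrow> real \<Rightarrow> real \<Rightarrow> real \<Rightarrow> real \<Rightarrow> vfield" where
  "affine_field a b c d e f g = (\<lambda>(x, t, w). (a * x + b * t + c, d * t + e, f * w + g))"

lemma vf_bracket_affine_field:
  "vf_bracket (affine_field a b c d e f g) (affine_field a' b' c' d' e' f' g') =
   affine_field 0 (a' * b + b' * d - a * b' - b * d') (a' * c + b' * e - a * c' - b * e')
     0 (d' * e - d * e') 0 (f' * g - f * g')"
proof -
  have lin: "bounded_linear (\<lambda>p :: real \<times> real \<times> real.
      (a * fst p + b * fst (snd p), d * fst (snd p), f * snd (snd p)))" for a b d f :: real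
    by (intro bounded_linear_Pair bounded_linear_add bounded_linear_const_mult
        bounded_linear_fst bounded_linear_fst_comp bounded_linear_snd_comp
        bounded_linear_compose[OF bounded_linear_fst bounded_linear_snd]
        bounded_linear_compose[OF bounded_linear_snd bounded_linear_snd])
  have eq: "affine_field a b c d e f g = (\<lambda>p. (a * fst p + b * fst (snd p), d * fst (snd p),
      f * snd (snd p)) + (c, e, g))" for a b c d e f g
    by (auto simp: affine_field_def fun_eq_iff)
  show ?thesis
    unfolding eq vf_bracket_affine[OF lin lin] by (auto simp: fun_eq_iff algebra_simps)
qed

lemma affine_field_0: "0 = affine_field 0 0 0 0 0 0 0"
  by (auto simp: affine_field_def fun_eq_iff zero_prod_def)

lemma affine_field_add:
  "affine_field a b c d e f g + affine_field a' b' c' d' e' f' g' =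
   affine_field (a + a') (b + b') (c + c') (d + d') (e + e') (f + f') (g + g')"
  by (auto simp: affine_field_def fun_eq_iff algebra_simps)

lemma affine_field_scaleR:
  "r *\<^sub>R affine_field a b c d e f g =
   affine_field (r * a) (r * b) (r * c) (r * d) (r * e) (r * f) (r * g)"
  by (auto simp: affine_field_def fun_eq_iff algebra_simps scaleR_fun_def)

lemma affine_field_eq_iff:
  "affine_field a b c d e f g = affine_field a' b' c' d' e' f' g' \<longleftrightarrow>
   a = a' \<and> b = b' \<and> c = c' \<and> d = d' \<and> e = e' \<and> f = f' \<and> g = g'" (is "?l = ?r \<longleftrightarrow> ?P")
proof
  assume "?l = ?r"
  then have eq: "?l p = ?r p" for p by simp
  show ?P
    using eq[of "(0, 0, 0)"] eq[of "(1, 0, 0)"] eq[of "(0, 1, 0)"] eq[of "(0, 0, 1)"]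
    by (simp add: affine_field_def)
qed auto

lemma gardner_basis_affine:
  "v1 = (affine_field 0 0 1 0 0 0 0, affine_field 0 0 0 0 0 0 0)"
  "v2 = (affine_field 0 0 0 0 1 0 0, affine_field 0 0 0 0 0 0 0)"
  "v3 = (affine_field 0 6 0 0 0 0 (-1), affine_field 0 0 0 0 0 2 0)"
  "v4 = (affine_field 0 0 0 0 0 0 0, affine_field 0 0 1 0 0 0 0)"
  "v5 = (affine_field 0 0 0 0 0 0 0, affine_field 0 0 0 0 1 0 0)"
  "v6 = (affine_field 0 0 0 0 0 0 0, affine_field 0 6 0 0 0 0 (-1))"
  "v7 = (affine_field 0 0 0 0 0 0 0, affine_field 1 0 0 3 0 (-2) 0)"
  by (auto simp: v1_def v2_def v3_def v4_def v5_def v6_def v7_def eps_times_def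
      affine_field_def fun_eq_iff zero_prod_def)

lemmas approx_calc = gardner_basis_affine approx_bracket_def vf_bracket_affine_field
  affine_field_add affine_field_scaleR affine_field_eq_iff

lemma gardner_brackets:
  "approx_bracket v1 v7 = v4"
  "approx_bracket v2 v3 = 6 *\<^sub>R v1"
  "approx_bracket v2 v6 = 6 *\<^sub>R v4"
  "approx_bracket v2 v7 = 3 *\<^sub>R v5"
  "approx_bracket v3 v5 = (- 6) *\<^sub>R v4"
  "approx_bracket v3 v7 = (- 2) *\<^sub>R v6"
  by (simp_all add: approx_calc)

lemma gardner_brackets_zero:
  "approx_bracket v1 v2 = 0" "approx_bracket v1 v3 = 0" "approx_bracket v1 v4 = 0"
  "approx_bracket v1 v5 = 0" "approx_bracket v1 v6 = 0" "approx_bracket v2 v4 = 0"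
  "approx_bracket v2 v5 = 0" "approx_bracket v3 v4 = 0" "approx_bracket v3 v6 = 0"
  "approx_bracket v4 v5 = 0" "approx_bracket v4 v6 = 0" "approx_bracket v4 v7 = 0"
  "approx_bracket v5 v6 = 0" "approx_bracket v5 v7 = 0" "approx_bracket v6 v7 = 0"
  by (simp_all add: approx_calc zero_prod_def affine_field_0)

lemma approx_bracket_antisym: "approx_bracket X Y = - approx_bracket Y X"
  by (auto simp: approx_bracket_def vf_bracket_def fun_eq_iff prod_eq_iff)

lemma gardner_basis_linear_independence:
  "a1 *\<^sub>R v1 + a2 *\<^sub>R v2 + a3 *\<^sub>R v3 + a4 *\<^sub>R v4 + a5 *\<^sub>R v5 + a6 *\<^sub>R v6 + a7 *\<^sub>R v7 = 0 \<longleftrightarrow>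
   a1 = 0 \<and> a2 = 0 \<and> a3 = 0 \<and> a4 = 0 \<and> a5 = 0 \<and> a6 = 0 \<and> a7 = 0"
  by (auto simp: approx_calc zero_prod_def affine_field_0)

lemma gardner_basis_distinct: "distinct [v1, v2, v3, v4, v5, v6, v7]"
  by (simp add: approx_calc)

lemma independent_gardner_basis: "independent gardner_basis"
proof -
  have "u v1 = 0 \<and> u v2 = 0 \<and> u v3 = 0 \<and> u v4 = 0 \<and> u v5 = 0 \<and> u v6 = 0 \<and> u v7 = 0"
    if "(\<Sum>v\<in>gardner_basis. u v *\<^sub>R v) = 0" for u
    using that gardner_basis_distinct
      gardner_basis_linear_independence[of "u v1" "u v2" "u v3" "u v4" "u v5" "u v6" "u v7"]
    by (simp add: gardner_basis_def add.assoc)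
  then show ?thesis
    by (intro independent_if_scalars_zero) (auto simp: gardner_basis_def)
qed

lemma dim_gardner_algebra: "dim gardner_algebra = 7"
  using gardner_basis_distinct dim_eq_card_independent[OF independent_gardner_basis]
  by (simp add: gardner_algebra_def gardner_basis_def)

end

theory Submission
  imports Defs
begin

text \<open>In the coordinates \<open>(a1, \<dots>, a7)\<close> with respect to the basis, each \<open>ad v\<^sub>i\<close> squares to zero,
  so \<open>Ad (exp (\<mu> v\<^sub>i))\<close> is the elementary linear map \<open>X \<mapsto> X - \<mu> [v\<^sub>i, X]\<close>
  (lemma \<open>Ad_exp_element\<close>). It changes at most the coordinates \<open>a1\<close>, \<open>a4\<close>, \<open>a5\<close>, \<open>a6\<close>,
  which are those of the derived algebra, the span of \<open>v1\<close>, \<open>v4\<close>, \<open>v5\<close>, \<open>v6\<close>. Hence \<open>a2\<close>, \<open>a3\<close>, \<open>a7\<close> are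
  invariant, and so is the quadratic form \<open>J = a1 a7 - 2 a3 a5 - 3 a2 a6\<close>. On the derived algebra
  \<open>a2 = a3 = a7 = 0\<close>, where \<open>J\<close> vanishes, only \<open>a4\<close> can still move, by multiples of \<open>a1\<close>,
  \<open>a5\<close> and \<open>a6\<close>; so \<open>a1\<close>, \<open>a5\<close>, \<open>a6\<close> are invariant there, and \<open>a4\<close> is invariant once these vanish too
  (lemma \<open>Ad_group_element\<close>).

  These invariants are complete. Take the first nonzero entry in the order
  \<open>a7, a3, a2, a6, a5, a1, a4\<close> and rescale it to \<open>1\<close>. The moves then remove all remaining
  coordinates except those that the invariants determine (lemma \<open>ex_normal_coords\<close>); in the
  first three cases \<open>J\<close> fixes the last free parameter, which is
  \<open>a1\<close>, \<open>a5\<close> or \<open>a6\<close> respectively. The vectors so obtained are the listed generators.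
  Conversely two of them whose invariants agree up to rescaling have the same leading entry, the
  scaling factor is \<open>1\<close>, and the parameters are read off from the invariants
  (lemma \<open>normal_coords_unique\<close>).\<close>

section \<open>Coordinates on the algebra\<close>

type_synonym coords = "real \<times> real \<times> real \<times> real \<times> real \<times> real \<times> real"

definition element :: "coords \<Rightarrow> approx_op" where
  "element = (\<lambda>(a1, a2, a3, a4, a5, a6, a7).
     a1 *\<^sub>R v1 + a2 *\<^sub>R v2 + a3 *\<^sub>R v3 + a4 *\<^sub>R v4 + a5 *\<^sub>R v5 + a6 *\<^sub>R v6 + a7 *\<^sub>R v7)"

lemma element_affine:
  "element (a1, a2, a3, a4, a5, a6, a7) =
     (affine_field 0 (6 * a3) a1 0 a2 0 (- a3),
      affine_field a7 (6 * a6) a4 (3 * a7) a5 (2 * a3 - 2 * a7) (- a6))"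
  by (simp add: element_def approx_calc)

lemma element_eq_iff [simp]: "element a = element b \<longleftrightarrow> a = b"
  by (cases a; cases b) (auto simp: element_affine affine_field_eq_iff)

lemma element_scaleR: "element (c *\<^sub>R a) = c *\<^sub>R element a"
  by (cases a) (simp add: element_affine affine_field_scaleR algebra_simps)

lemma element_diff: "element (a - b) = element a - element b"
  by (cases a; cases b) (simp add: element_def algebra_simps)

lemma element_0 [simp]: "element 0 = 0"
  using element_scaleR[of 0 0] by simp

lemma element_zeros [simp]: "element (0, 0, 0, 0, 0, 0, 0) = 0"
  by (simp add: element_def)

lemma element_eq_0_iff [simp]: "element a = 0 \<longleftrightarrow> a = 0"
  by (metis element_0 element_eq_iff)

lemma gardner_algebra_eq_range: "gardner_algebra = range element"
proof (intro equalityI subsetI)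
  fix X assume "X \<in> gardner_algebra"
  then obtain a1 a2 a3 a4 a5 a6 a7 where
    "X - a1 *\<^sub>R v1 - a2 *\<^sub>R v2 - a3 *\<^sub>R v3 - a4 *\<^sub>R v4 - a5 *\<^sub>R v5 - a6 *\<^sub>R v6 - a7 *\<^sub>R v7 = 0"
    unfolding gardner_algebra_def gardner_basis_def span_breakdown_eq span_empty by blast
  then have "X = element (a1, a2, a3, a4, a5, a6, a7)"
    by (simp add: element_def algebra_simps)
  then show "X \<in> range element" by blast
next
  fix X assume "X \<in> range element"
  then obtain a where "X = element a" by blast
  then show "X \<in> gardner_algebra"
    unfolding gardner_algebra_def
    by (cases a) (auto simp: element_def gardner_basis_def span_base intro!: span_add span_scale)
qed

lemma approx_bracket_element:
  "approx_bracket (element (a1, a2, a3, a4, a5, a6, a7)) (element (b1, b2, b3, b4, b5, b6, b7)) =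
   element (6 * (a2 * b3 - a3 * b2), 0, 0,
     (a1 * b7 - a7 * b1) + 6 * (a2 * b6 - a6 * b2) - 6 * (a3 * b5 - a5 * b3),
     3 * (a2 * b7 - a7 * b2), - 2 * (a3 * b7 - a7 * b3), 0)"
  by (simp add: element_affine approx_bracket_def vf_bracket_affine_field affine_field_add
      affine_field_eq_iff algebra_simps)

lemma gardner_basis_element:
  "v1 = element (1, 0, 0, 0, 0, 0, 0)"
  "v2 = element (0, 1, 0, 0, 0, 0, 0)"
  "v3 = element (0, 0, 1, 0, 0, 0, 0)"
  "v4 = element (0, 0, 0, 1, 0, 0, 0)"
  "v5 = element (0, 0, 0, 0, 1, 0, 0)"
  "v6 = element (0, 0, 0, 0, 0, 1, 0)"
  "v7 = element (0, 0, 0, 0, 0, 0, 1)"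
  by (simp_all add: element_def)


section \<open>The adjoint action in coordinates\<close>

text \<open>The second hypothesis is not automatic: for a field \<open>v\<close> that is not differentiable, the value
  of \<open>frechet_derivative\<close> is an arbitrary function, which may be nonzero at \<open>0\<close>.\<close>

lemma Ad_exp_of_square_zero:
  assumes "approx_bracket v (approx_bracket v X) = 0" "approx_bracket v 0 = 0"
  shows "Ad_exp \<mu> v X = X - \<mu> *\<^sub>R approx_bracket v X"
proof -
  define f where "f n = ((- \<mu>) ^ n / fact n) *\<^sub>R (approx_bracket v ^^ n) X" for n
  have "(approx_bracket v ^^ (n + 2)) X = 0" for n
    by (induction n) (use assms in \<open>simp_all add: numeral_2_eq_2\<close>)
  then have "f n = 0" if "n \<notin> {0, 1}" for n
    using that le_add_diff_inverse2[of 2 n] unfolding f_def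
    by (metis One_nat_def insert_iff less_2_cases not_less scaleR_zero_right)
  then have "f sums sum f {0, 1}"
    by (intro sums_finite) auto
  then have "suminf f = sum f {0, 1}"
    by (rule approx_op_sums_unique)
  also have "sum f {0, 1} = X - \<mu> *\<^sub>R approx_bracket v X"
    by (simp add: f_def)
  finally show ?thesis
    unfolding Ad_exp_def f_def .
qed

lemma approx_bracket_element_0: "approx_bracket (element a) 0 = 0"
  using approx_bracket_element[of _ _ _ _ _ _ _ 0 0 0 0 0 0 0]
  by (cases a) simp

text \<open>The Lie series stops after the linear term because \<open>ad v\<close> squares to zero for each basis
  element \<open>v\<close>. Sums of basis elements can behave differently: \<open>(ad (v2 + v7))\<^sup>2 v3 = 6 v4\<close>.\<close>

lemma Ad_exp_element:
  "Ad_exp \<mu> v1 (element (a1, a2, a3, a4, a5, a6, a7)) =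
     element (a1, a2, a3, a4 - \<mu> * a7, a5, a6, a7)"
  "Ad_exp \<mu> v2 (element (a1, a2, a3, a4, a5, a6, a7)) =
     element (a1 - 6 * \<mu> * a3, a2, a3, a4 - 6 * \<mu> * a6, a5 - 3 * \<mu> * a7, a6, a7)"
  "Ad_exp \<mu> v3 (element (a1, a2, a3, a4, a5, a6, a7)) =
     element (a1 + 6 * \<mu> * a2, a2, a3, a4 + 6 * \<mu> * a5, a5, a6 + 2 * \<mu> * a7, a7)"
  "Ad_exp \<mu> v4 (element (a1, a2, a3, a4, a5, a6, a7)) =
     element (a1, a2, a3, a4, a5, a6, a7)"
  "Ad_exp \<mu> v5 (element (a1, a2, a3, a4, a5, a6, a7)) =
     element (a1, a2, a3, a4 - 6 * \<mu> * a3, a5, a6, a7)"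
  "Ad_exp \<mu> v6 (element (a1, a2, a3, a4, a5, a6, a7)) =
     element (a1, a2, a3, a4 + 6 * \<mu> * a2, a5, a6, a7)"
  "Ad_exp \<mu> v7 (element (a1, a2, a3, a4, a5, a6, a7)) =
     element (a1, a2, a3, a4 + \<mu> * a1, a5 + 3 * \<mu> * a2, a6 - 2 * \<mu> * a3, a7)"
  unfolding gardner_basis_element
  by (subst Ad_exp_of_square_zero;
      simp add: approx_bracket_element approx_bracket_element_0
        flip: element_scaleR element_diff)+

text \<open>The nested cases follow two ideals: the derived algebra \<open>a2 = a3 = a7 = 0\<close>, and inside it
  the centre spanned by \<open>v4\<close>. On each of them the previous invariants vanish and new ones
  appear.\<close>

definition same_invariants :: "coords \<Rightarrow> coords \<Rightarrow> bool" where
  "same_invariants = (\<lambda>(a1, a2, a3, a4, a5, a6, a7) (b1, b2, b3, b4, b5, b6, b7).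
     a2 = b2 \<and> a3 = b3 \<and> a7 = b7 \<and>
     a1 * a7 - 2 * a3 * a5 - 3 * a2 * a6 = b1 * b7 - 2 * b3 * b5 - 3 * b2 * b6 \<and>
     (a2 = 0 \<and> a3 = 0 \<and> a7 = 0 \<longrightarrow> a1 = b1 \<and> a5 = b5 \<and> a6 = b6 \<and>
       (a1 = 0 \<and> a5 = 0 \<and> a6 = 0 \<longrightarrow> a4 = b4)))"

lemma same_invariants_refl: "same_invariants a a"
  by (cases a) (simp add: same_invariants_def)

lemma same_invariants_sym: "same_invariants a b \<Longrightarrow> same_invariants b a"
  by (cases a; cases b) (auto simp: same_invariants_def)

lemma same_invariants_trans: "same_invariants a b \<Longrightarrow> same_invariants b c \<Longrightarrow> same_invariants a c"
  by (cases a; cases b; cases c) (auto simp: same_invariants_def)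

lemma same_invariants_scaleR:
  assumes "same_invariants a b"
  shows "same_invariants (c *\<^sub>R a) (c *\<^sub>R b)"
proof (cases "c = 0")
  case False
  obtain a1 a2 a3 a4 a5 a6 a7 where a: "a = (a1, a2, a3, a4, a5, a6, a7)" by (cases a)
  obtain b1 b2 b3 b4 b5 b6 b7 where b: "b = (b1, b2, b3, b4, b5, b6, b7)" by (cases b)
  have "a1 * a7 - 2 * a3 * a5 - 3 * a2 * a6 = b1 * b7 - 2 * b3 * b5 - 3 * b2 * b6"
    using assms by (auto simp add: a b same_invariants_def)
  then have "c * c * (a1 * a7 - 2 * a3 * a5 - 3 * a2 * a6) =
      c * c * (b1 * b7 - 2 * b3 * b5 - 3 * b2 * b6)"
    by simp
  then show ?thesis
    using assms False unfolding a b same_invariants_def by (auto simp: algebra_simps)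
qed (simp add: same_invariants_refl)

lemma Ad_exp_same_invariants:
  assumes "v \<in> gardner_basis"
  shows "\<exists>b. same_invariants a b \<and> (\<forall>c. Ad_exp \<mu> v (element (c *\<^sub>R a)) = element (c *\<^sub>R b))"
proof -
  obtain a1 a2 a3 a4 a5 a6 a7 where a: "a = (a1, a2, a3, a4, a5, a6, a7)" by (cases a)
  from assms consider "v = v1" | "v = v2" | "v = v3" | "v = v4" | "v = v5" | "v = v6" | "v = v7"
    unfolding gardner_basis_def by blast
  then show ?thesis
  proof cases
    case 1
    then show ?thesis
      by (intro exI[of _ "(a1, a2, a3, a4 - \<mu> * a7, a5, a6, a7)"])
        (auto simp: a Ad_exp_element same_invariants_def algebra_simps)
  next
    case 2
    then show ?thesis
      by (intro exI[of _ "(a1 - 6 * \<mu> * a3, a2, a3, a4 - 6 * \<mu> * a6, a5 - 3 * \<mu> * a7, a6, a7)"])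
        (auto simp: a Ad_exp_element same_invariants_def algebra_simps)
  next
    case 3
    then show ?thesis
      by (intro exI[of _ "(a1 + 6 * \<mu> * a2, a2, a3, a4 + 6 * \<mu> * a5, a5, a6 + 2 * \<mu> * a7, a7)"])
        (auto simp: a Ad_exp_element same_invariants_def algebra_simps)
  next
    case 4
    then show ?thesis
      by (intro exI[of _ "a"])
        (auto simp: a Ad_exp_element same_invariants_def algebra_simps)
  next
    case 5
    then show ?thesis
      by (intro exI[of _ "(a1, a2, a3, a4 - 6 * \<mu> * a3, a5, a6, a7)"])
        (auto simp: a Ad_exp_element same_invariants_def algebra_simps)
  next
    case 6
    then show ?thesis
      by (intro exI[of _ "(a1, a2, a3, a4 + 6 * \<mu> * a2, a5, a6, a7)"])
        (auto simp: a Ad_exp_element same_invariants_def algebra_simps)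
  next
    case 7
    then show ?thesis
      by (intro exI[of _ "(a1, a2, a3, a4 + \<mu> * a1, a5 + 3 * \<mu> * a2, a6 - 2 * \<mu> * a3, a7)"])
        (auto simp: a Ad_exp_element same_invariants_def algebra_simps)
  qed
qed

text \<open>The witness \<open>b\<close> is chosen before the scalar \<open>c\<close>: this homogeneity is what makes the image
  of a line the line through the image.\<close>

lemma Ad_group_element:
  assumes "\<phi> \<in> Ad_group"
  shows "\<exists>b. same_invariants a b \<and> (\<forall>c. \<phi> (element (c *\<^sub>R a)) = element (c *\<^sub>R b))"
  using assms
proof induction
  case id
  show ?case by (intro exI[of _ a]) (simp add: same_invariants_refl)
next
  case (step \<phi> v \<mu>)
  then show ?case
    by (metis Ad_exp_same_invariants comp_apply same_invariants_trans)
qed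


section \<open>Normal forms\<close>

definition normal_coords :: "coords set" where
  "normal_coords =
     {(1, 0, 0, 0, 0, 0, 0)} \<union>
     {(0, 0, 0, 1, 0, 0, 0)} \<union>
     {(0, 1, 0, 0, 0, \<alpha>, 0) | \<alpha>. True} \<union>
     {(\<alpha>, 0, 0, 0, 1, 0, 0) | \<alpha>. True} \<union>
     {(0, \<alpha>, 1, 0, \<beta>, 0, 0) | \<alpha> \<beta>. True} \<union>
     {(\<alpha>, 0, 0, 0, \<beta>, 1, 0) | \<alpha> \<beta>. True} \<union>
     {(\<alpha>, \<beta>, \<gamma>, 0, 0, 0, 1) | \<alpha> \<beta> \<gamma>. True}"

lemma normal_coords_nonzero: "n \<in> normal_coords \<Longrightarrow> n \<noteq> 0"
  by (auto simp: normal_coords_def zero_prod_def)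

text \<open>Which invariants vanish does not change under rescaling, so the leading entries stand in
  the same position. The leading entry is \<open>1\<close> on both sides and is itself an invariant, which forces \<open>r = 1\<close>. Every
  parameter is then an invariant coordinate or a nonzero multiple of the value of \<open>J\<close>.\<close>

lemma normal_coords_unique:
  assumes "n \<in> normal_coords" "n' \<in> normal_coords" "same_invariants n (r *\<^sub>R n')"
  shows "n = n'"
  using assms unfolding normal_coords_def
  by (elim UnE; clarsimp simp: same_invariants_def)

definition Ad_orbit :: "approx_op \<Rightarrow> approx_op set" where
  "Ad_orbit X = (\<lambda>\<phi>. \<phi> X) ` Ad_group"

lemma Ad_orbit_refl: "X \<in> Ad_orbit X"
  unfolding Ad_orbit_def by (rule image_eqI[of _ _ id]) (simp_all add: Ad_group.id)

lemma Ad_orbit_step: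
  assumes "Y \<in> Ad_orbit X" "v \<in> gardner_basis"
  shows "Ad_exp \<mu> v Y \<in> Ad_orbit X"
proof -
  obtain \<phi> where "\<phi> \<in> Ad_group" "Y = \<phi> X"
    using assms(1) unfolding Ad_orbit_def by blast
  then show ?thesis
    unfolding Ad_orbit_def
    by (intro image_eqI[of _ _ "Ad_exp \<mu> v \<circ> \<phi>"]) (simp_all add: Ad_group.step assms(2))
qed

text \<open>Each case clears the coordinates that are not determined by the invariants, the central
  coordinate \<open>a4\<close> last since clearing the others disturbs it.\<close>

lemma ex_normal_coords:
  assumes "a \<noteq> 0"
  shows "\<exists>c n. c \<noteq> 0 \<and> n \<in> normal_coords \<and> element n \<in> Ad_orbit (element (c *\<^sub>R a))"
proof -
  obtain a1 a2 a3 a4 a5 a6 a7 where a: "a = (a1, a2, a3, a4, a5, a6, a7)" by (cases a)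
  have basis: "v1 \<in> gardner_basis" "v2 \<in> gardner_basis" "v3 \<in> gardner_basis"
    "v5 \<in> gardner_basis" "v6 \<in> gardner_basis" "v7 \<in> gardner_basis"
    by (auto simp: gardner_basis_def)
  have ex: ?thesis if "c \<noteq> 0" "n \<in> normal_coords" "element n \<in> Ad_orbit (element (c *\<^sub>R a))" for c n
    using that by blast
  have start: "element (c * a1, c * a2, c * a3, c * a4, c * a5, c * a6, c * a7) \<in>
      Ad_orbit (element (c *\<^sub>R a))" for c
    using Ad_orbit_refl by (simp add: a)
  consider "a7 \<noteq> 0"
    | "a7 = 0" "a3 \<noteq> 0"
    | "a7 = 0" "a3 = 0" "a2 \<noteq> 0"
    | "a7 = 0" "a3 = 0" "a2 = 0" "a6 \<noteq> 0"
    | "a7 = 0" "a3 = 0" "a2 = 0" "a6 = 0" "a5 \<noteq> 0"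
    | "a7 = 0" "a3 = 0" "a2 = 0" "a6 = 0" "a5 = 0" "a1 \<noteq> 0"
    | "a7 = 0" "a3 = 0" "a2 = 0" "a6 = 0" "a5 = 0" "a1 = 0" "a4 \<noteq> 0"
    using assms by (auto simp: a zero_prod_def)
  then show ?thesis
  proof cases
    case 1
    define c where "c = 1 / a7"
    let ?O = "Ad_orbit (element (c *\<^sub>R a))"
    define b1 b2 b3 b4 b5 b6 where b: "b1 = c * a1" "b2 = c * a2" "b3 = c * a3" "b4 = c * a4"
      "b5 = c * a5" "b6 = c * a6"
    have "element (b1, b2, b3, b4, b5, b6, 1) \<in> ?O"
      using start[of c] 1 by (simp add: b c_def)
    from Ad_orbit_step[OF this basis(2), of "b5 / 3"]
    obtain d1 d4 where "element (d1, b2, b3, d4, 0, b6, 1) \<in> ?O"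
      by (auto simp: Ad_exp_element)
    from Ad_orbit_step[OF this basis(3), of "- b6 / 2"]
    obtain e1 e4 where "element (e1, b2, b3, e4, 0, 0, 1) \<in> ?O"
      by (auto simp: Ad_exp_element)
    from Ad_orbit_step[OF this basis(1), of e4]
    have "element (e1, b2, b3, 0, 0, 0, 1) \<in> ?O"
      by (simp add: Ad_exp_element)
    then show ?thesis
      by (rule ex[rotated 2]) (use 1 in \<open>auto simp: c_def normal_coords_def\<close>)
  next
    case 2
    define c where "c = 1 / a3"
    let ?O = "Ad_orbit (element (c *\<^sub>R a))"
    define b1 b2 b4 b5 b6 where b: "b1 = c * a1" "b2 = c * a2" "b4 = c * a4"
      "b5 = c * a5" "b6 = c * a6"
    have "element (b1, b2, 1, b4, b5, b6, 0) \<in> ?O"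
      using start[of c] 2 by (simp add: b c_def)
    from Ad_orbit_step[OF this basis(2), of "b1 / 6"]
    obtain d4 where "element (0, b2, 1, d4, b5, b6, 0) \<in> ?O"
      by (auto simp: Ad_exp_element)
    from Ad_orbit_step[OF this basis(6), of "b6 / 2"]
    obtain e4 e5 where "element (0, b2, 1, e4, e5, 0, 0) \<in> ?O"
      by (auto simp: Ad_exp_element)
    from Ad_orbit_step[OF this basis(4), of "e4 / 6"]
    have "element (0, b2, 1, 0, e5, 0, 0) \<in> ?O"
      by (simp add: Ad_exp_element)
    then show ?thesis
      by (rule ex[rotated 2]) (use 2 in \<open>auto simp: c_def normal_coords_def\<close>)
  next
    case 3
    define c where "c = 1 / a2"
    let ?O = "Ad_orbit (element (c *\<^sub>R a))"
    define b1 b4 b5 b6 where b: "b1 = c * a1" "b4 = c * a4" "b5 = c * a5" "b6 = c * a6"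
    have "element (b1, 1, 0, b4, b5, b6, 0) \<in> ?O"
      using start[of c] 3 by (simp add: b c_def)
    from Ad_orbit_step[OF this basis(3), of "- b1 / 6"]
    obtain d4 where "element (0, 1, 0, d4, b5, b6, 0) \<in> ?O"
      by (auto simp: Ad_exp_element)
    from Ad_orbit_step[OF this basis(6), of "- b5 / 3"]
    obtain e4 where "element (0, 1, 0, e4, 0, b6, 0) \<in> ?O"
      by (auto simp: Ad_exp_element)
    from Ad_orbit_step[OF this basis(5), of "- e4 / 6"]
    have "element (0, 1, 0, 0, 0, b6, 0) \<in> ?O"
      by (simp add: Ad_exp_element)
    then show ?thesis
      by (rule ex[rotated 2]) (use 3 in \<open>auto simp: c_def normal_coords_def\<close>)
  next
    case 4
    define c where "c = 1 / a6"
    have "element (c * a1, 0, 0, c * a4, c * a5, 1, 0) \<in> Ad_orbit (element (c *\<^sub>R a))"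
      using start[of c] 4 by (simp add: c_def)
    from Ad_orbit_step[OF this basis(2), of "c * a4 / 6"]
    have "element (c * a1, 0, 0, 0, c * a5, 1, 0) \<in> Ad_orbit (element (c *\<^sub>R a))"
      by (simp add: Ad_exp_element)
    then show ?thesis
      by (rule ex[rotated 2]) (use 4 in \<open>auto simp: c_def normal_coords_def\<close>)
  next
    case 5
    define c where "c = 1 / a5"
    have "element (c * a1, 0, 0, c * a4, 1, 0, 0) \<in> Ad_orbit (element (c *\<^sub>R a))"
      using start[of c] 5 by (simp add: c_def)
    from Ad_orbit_step[OF this basis(3), of "- c * a4 / 6"]
    have "element (c * a1, 0, 0, 0, 1, 0, 0) \<in> Ad_orbit (element (c *\<^sub>R a))"
      by (simp add: Ad_exp_element)
    then show ?thesis
      by (rule ex[rotated 2]) (use 5 in \<open>auto simp: c_def normal_coords_def\<close>)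
  next
    case 6
    define c where "c = 1 / a1"
    have "element (1, 0, 0, c * a4, 0, 0, 0) \<in> Ad_orbit (element (c *\<^sub>R a))"
      using start[of c] 6 by (simp add: c_def)
    from Ad_orbit_step[OF this basis(6), of "- c * a4"]
    have "element (1, 0, 0, 0, 0, 0, 0) \<in> Ad_orbit (element (c *\<^sub>R a))"
      by (simp add: Ad_exp_element)
    then show ?thesis
      by (rule ex[rotated 2]) (use 6 in \<open>auto simp: c_def normal_coords_def\<close>)
  next
    case 7
    have "element (0, 0, 0, 1, 0, 0, 0) \<in> Ad_orbit (element ((1 / a4) *\<^sub>R a))"
      using start[of "1 / a4"] 7 by simp
    then show ?thesis
      by (rule ex[rotated 2]) (use 7 in \<open>auto simp: normal_coords_def\<close>)
  qed
qed


section \<open>One-dimensional subalgebras\<close>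

lemma span_element: "span {element a} = range (\<lambda>c. element (c *\<^sub>R a))"
  by (simp add: span_singleton element_scaleR)

lemma one_dim_subalgebra_span:
  assumes "a \<noteq> 0"
  shows "one_dim_subalgebra (span {element a})"
proof -
  have "span {element a} \<subseteq> gardner_algebra"
    unfolding gardner_algebra_eq_range by (auto simp: span_element)
  moreover have "approx_bracket X Y \<in> span {element a}"
    if XY: "X \<in> span {element a}" "Y \<in> span {element a}" for X Y
  proof -
    obtain r s where "X = element (r *\<^sub>R a)" "Y = element (s *\<^sub>R a)"
      using XY unfolding span_element by blast
    then have "approx_bracket X Y = 0"
      by (cases a) (simp add: approx_bracket_element)
    then show ?thesis by (simp add: span_zero)
  qed
  moreover have "dim (span {element a}) = 1"
    using assms dim_eq_card_independent[of "{element a}"] by simp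
  ultimately show ?thesis
    unfolding one_dim_subalgebra_def by simp
qed

lemma one_dim_subalgebraE:
  assumes "one_dim_subalgebra h"
  obtains a where "a \<noteq> 0" "h = span {element a}"
proof -
  obtain B where B: "B \<subseteq> h" "independent B" "h \<subseteq> span B" "card B = dim h"
    using basis_exists by blast
  with assms obtain X where X: "B = {X}"
    by (metis card_1_singletonE one_dim_subalgebra_def)
  with B assms obtain a where "X = element a"
    unfolding one_dim_subalgebra_def gardner_algebra_eq_range by blast
  moreover have "h = span {X}"
    using B X assms by (metis one_dim_subalgebra_def span_minimal subset_antisym)
  moreover have "X \<noteq> 0"
    using B X dependent_zero by blast
  ultimately show ?thesis using that by simp
qed

lemma image_span_singleton:
  assumes "\<And>c. \<phi> (c *\<^sub>R X) = c *\<^sub>R Y"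
  shows "\<phi> ` span {X} = span {Y}"
  using assms by (auto simp: span_singleton image_image)

lemma span_singleton_scaleR:
  assumes "c \<noteq> 0"
  shows "span {c *\<^sub>R X} = span {X}"
  using span_image_scale[of "{X}" "\<lambda>_. c"] assms by simp

lemma equivalent_subalgebras_if_orbit:
  assumes "element n \<in> Ad_orbit (element a)"
  shows "equivalent_subalgebras (span {element a}) (span {element n})"
proof -
  obtain \<phi> where \<phi>: "\<phi> \<in> Ad_group" "element n = \<phi> (element a)"
    using assms by (auto simp: Ad_orbit_def)
  obtain b where b: "\<And>c. \<phi> (element (c *\<^sub>R a)) = element (c *\<^sub>R b)"
    using Ad_group_element[OF \<phi>(1)] by blast
  have "n = b"
    using b[of 1] \<phi>(2) by (metis element_eq_iff scaleR_one)
  then have "\<phi> ` span {element a} = span {element n}"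
    using b by (intro image_span_singleton) (simp add: element_scaleR)
  then show ?thesis
    unfolding equivalent_subalgebras_def using \<phi>(1) by blast
qed

lemma equivalent_subalgebras_same_invariants:
  assumes "equivalent_subalgebras (span {element a}) (span {element n})" "n \<noteq> 0"
  shows "\<exists>c. c \<noteq> 0 \<and> same_invariants a (c *\<^sub>R n)"
proof -
  obtain \<phi> where \<phi>: "\<phi> \<in> Ad_group" "span {element n} = \<phi> ` span {element a}"
    using assms(1) unfolding equivalent_subalgebras_def by blast
  obtain b where b: "same_invariants a b" "\<And>c. \<phi> (element (c *\<^sub>R a)) = element (c *\<^sub>R b)"
    using Ad_group_element[OF \<phi>(1)] by blast
  have "span {element n} = span {element b}"
    using b(2) \<phi>(2) image_span_singleton[of \<phi>] by (simp add: element_scaleR)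
  then have "element n \<in> span {element b}"
    using span_base by blast
  then obtain r where r: "n = r *\<^sub>R b"
    by (auto simp: span_element simp del: scaleR_cancel_left scaleR_cancel_right)
  with assms(2) have "r \<noteq> 0" by auto
  then have "b = inverse r *\<^sub>R n" using r by simp
  then show ?thesis
    using b(1) \<open>r \<noteq> 0\<close> by (metis nonzero_imp_inverse_nonzero)
qed

lemma optimal_system_normal_coords: "optimal_system ((\<lambda>n. span {element n}) ` normal_coords)"
  unfolding optimal_system_def
proof (intro conjI ballI allI impI)
  fix k assume "k \<in> (\<lambda>n. span {element n}) ` normal_coords"
  then show "one_dim_subalgebra k"
    using one_dim_subalgebra_span normal_coords_nonzero by blast
next
  fix h assume "one_dim_subalgebra h"
  then obtain a where a: "a \<noteq> 0" "h = span {element a}"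
    by (rule one_dim_subalgebraE)
  obtain c n where n: "c \<noteq> 0" "n \<in> normal_coords" "element n \<in> Ad_orbit (element (c *\<^sub>R a))"
    using ex_normal_coords[OF a(1)] by blast
  have equiv: "equivalent_subalgebras h (span {element n})"
    using equivalent_subalgebras_if_orbit[OF n(3)] n(1)
    by (simp add: a(2) element_scaleR span_singleton_scaleR)
  have unique: "n' = n"
    if n': "n' \<in> normal_coords" "equivalent_subalgebras h (span {element n'})" for n'
  proof -
    obtain r where r: "same_invariants a (r *\<^sub>R n)"
      using equivalent_subalgebras_same_invariants equiv normal_coords_nonzero[OF n(2)] a(2) by blast
    obtain s where s: "s \<noteq> 0" "same_invariants a (s *\<^sub>R n')"
      using equivalent_subalgebras_same_invariants n'(2) normal_coords_nonzero[OF n'(1)] a(2) by blast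
    (* Each normal form is related to the generator a of h; symmetry and transitivity relate the two. *)
    have "same_invariants (s *\<^sub>R n') (r *\<^sub>R n)"
      using r s(2) same_invariants_sym same_invariants_trans by blast
    from same_invariants_scaleR[OF this, of "inverse s"]
    have "same_invariants n' ((inverse s * r) *\<^sub>R n)"
      using s(1) by simp
    then show ?thesis
      using normal_coords_unique n'(1) n(2) by blast
  qed
  show "\<exists>!k. k \<in> (\<lambda>n. span {element n}) ` normal_coords \<and> equivalent_subalgebras h k"
    using n(2) equiv unique by blast
qed

theorem theorem4p3:
  shows "optimal_system
    ({span {v1}} \<union>
     {span {v4}} \<union>
     {span {v2 + \<alpha> *\<^sub>R v6} | \<alpha> :: real. True} \<union>
     {span {v5 + \<alpha> *\<^sub>R v1} | \<alpha> :: real. True} \<union>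
     {span {v3 + \<alpha> *\<^sub>R v2 + \<beta> *\<^sub>R v5} | \<alpha> \<beta> :: real. True} \<union>
     {span {v6 + \<alpha> *\<^sub>R v1 + \<beta> *\<^sub>R v5} | \<alpha> \<beta> :: real. True} \<union>
     {span {v7 + \<alpha> *\<^sub>R v1 + \<beta> *\<^sub>R v2 + \<gamma> *\<^sub>R v3} | \<alpha> \<beta> \<gamma> :: real. True})"
  (is "optimal_system ?L")
proof -
  have generators:
    "v1 = element (1, 0, 0, 0, 0, 0, 0)" "v4 = element (0, 0, 0, 1, 0, 0, 0)"
    "v2 + \<alpha> *\<^sub>R v6 = element (0, 1, 0, 0, 0, \<alpha>, 0)"
    "v5 + \<alpha> *\<^sub>R v1 = element (\<alpha>, 0, 0, 0, 1, 0, 0)"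
    "v3 + \<alpha> *\<^sub>R v2 + \<beta> *\<^sub>R v5 = element (0, \<alpha>, 1, 0, \<beta>, 0, 0)"
    "v6 + \<alpha> *\<^sub>R v1 + \<beta> *\<^sub>R v5 = element (\<alpha>, 0, 0, 0, \<beta>, 1, 0)"
    "v7 + \<alpha> *\<^sub>R v1 + \<beta> *\<^sub>R v2 + \<gamma> *\<^sub>R v3 = element (\<alpha>, \<beta>, \<gamma>, 0, 0, 0, 1)" for \<alpha> \<beta> \<gamma>
    by (simp_all add: element_def add_ac)
  (* The composite generators are folded first, while v1 still occurs in them unexpanded. *)
  have "(\<lambda>n. span {element n}) ` normal_coords = ?L"
    unfolding generators(3-)
    unfolding generators(1,2) normal_coords_def image_Un
    by (intro arg_cong2[where f = "(\<union>)"]) blast+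
  then show ?thesis
    using optimal_system_normal_coords by simp
qed

end
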